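(* Let $\Gamma=\langle A,B\rangle\subset\mathrm{PSL}_2(\mathbb{Z}[i])$ with $A=\begin{pmatrix}1&1\\0&1\end{pmatrix}$, $B=\begin{pmatrix}1&0\\ 1+i&1\end{pmatrix}$. If $X,Y\in\Gamma$ satisfy $\Gamma=\langle X,Y\rangle$ and $\mathrm{tr}\,X=\mathrm{tr}\,Y$, then $X$ and $Y$ are parabolic.
   Context: $\Gamma$ is the image of the discrete faithful representation of the Whitehead link group into $\mathrm{PSL}_2\mathbb{C}$; it is a finite-covolume Kleinian group with traces in $\mathbb{Z}[i]$, the ring of integers of its trace field $\mathbb{Q}(i)$. Traces are taken of lifts to $\mathrm{SL}_2\mathbb{C}$; "$\mathrm{tr}\,X=\mathrm{tr}\,Y$" means the elements admit lifts of equal trace. Parabolic means non-identity with $\mathrm{tr}^2=4$. *)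

theory Defs
  imports "HOL-Analysis.Analysis"
begin

type_synonym mat2 = "complex^2^2"

definition mat2 :: "complex \<Rightarrow> complex \<Rightarrow> complex \<Rightarrow> complex \<Rightarrow> mat2" where
  "mat2 a b c d = vector [vector [a, b], vector [c, d]]"

definition sl2_inv :: "mat2 \<Rightarrow> mat2" where
  "sl2_inv M = mat2 (M$2$2) (- M$1$2) (- M$2$1) (M$1$1)"

inductive_set sl2_gen :: "mat2 set \<Rightarrow> mat2 set" for S where
  one: "mat 1 \<in> sl2_gen S"
| mul: "x \<in> sl2_gen S \<Longrightarrow> s \<in> S \<Longrightarrow> x ** s \<in> sl2_gen S"
| mul_inv: "x \<in> sl2_gen S \<Longrightarrow> s \<in> S \<Longrightarrow> x ** sl2_inv s \<in> sl2_gen S"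

definition matA :: mat2 where "matA = mat2 1 1 0 1"
definition matB :: mat2 where "matB = mat2 1 0 (1 + \<i>) 1"

text \<open>Full preimage in SL(2,C) of Gamma = <A,B> in PSL(2,C).\<close>
definition Gamma_lift :: "mat2 set" where
  "Gamma_lift = sl2_gen {matA, matB, - mat 1}"

text \<open>Parabolic element of PSL(2,C), given by a lift M in SL(2,C).\<close>
definition parabolic :: "mat2 \<Rightarrow> bool" where
  "parabolic M \<longleftrightarrow> M \<noteq> mat 1 \<and> M \<noteq> - mat 1 \<and> (trace M)^2 = 4"

end

theory Submission
  imports Defs
begin

text \<open>
  Put \<open>K = XY - YX\<close>. As \<open>K\<close> and \<open>KX\<close>, \<open>KY\<close> are traceless, \<open>K S = S\<^sup>-\<^sup>1 K\<close> for \<open>S = X, Y\<close>;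
  hence the matrices \<open>N K\<close> with \<open>N\<close> integral over the Gaussian integers absorb the
  generators on both sides, and by the Leibniz rule they contain every additive commutator
  \<open>PQ - QP\<close> with \<open>P, Q\<close> in the group. Applied to \<open>A, B\<close> this shows that \<open>det K\<close> divides
  \<open>det (AB - BA) = -2\<i>\<close>. If \<open>x = tr X = tr Y\<close> and \<open>z = tr XY\<close>, then
  \<open>det K = - (z - 2) (z + 2 - x\<^sup>2)\<close>. Modulo \<open>1 + \<i>\<close> the group is unipotent, so all its traces
  are divisible by \<open>1 + \<i>\<close>, and so are both factors; therefore both equal \<open>1 + \<i>\<close> up to a unit.
  Among the resulting values of \<open>x\<^sup>2\<close> only \<open>4\<close> is a square of a Gaussian integer.
\<close>

section \<open>Gaussian integers, their units, and which squares occur\<close>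

definition gauss_ints :: "complex set" where
  "gauss_ints = {w. Re w \<in> \<int> \<and> Im w \<in> \<int>}"

lemma gauss_ints_intros [simp, intro]:
  "0 \<in> gauss_ints" "1 \<in> gauss_ints" "2 \<in> gauss_ints" "\<i> \<in> gauss_ints"
  "u \<in> gauss_ints \<Longrightarrow> v \<in> gauss_ints \<Longrightarrow> u + v \<in> gauss_ints"
  "u \<in> gauss_ints \<Longrightarrow> v \<in> gauss_ints \<Longrightarrow> u - v \<in> gauss_ints"
  "u \<in> gauss_ints \<Longrightarrow> v \<in> gauss_ints \<Longrightarrow> u * v \<in> gauss_ints"
  "u \<in> gauss_ints \<Longrightarrow> - u \<in> gauss_ints"
  by (auto simp: gauss_ints_def)

lemma gauss_intsE:
  assumes "w \<in> gauss_ints"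
  obtains a b :: int where "w = Complex (of_int a) (of_int b)"
  using assms unfolding gauss_ints_def by (auto elim!: Ints_cases) (metis complex_surj)

lemma int_sum_squares_eq_1:
  fixes a b :: int
  assumes "a\<^sup>2 + b\<^sup>2 = 1"
  shows "(a, b) \<in> {(1, 0), (-1, 0), (0, 1), (0, -1)}"
proof -
  have "a\<^sup>2 \<le> 1\<^sup>2" "b\<^sup>2 \<le> 1\<^sup>2"
    using assms zero_le_power2[of a] zero_le_power2[of b] by (simp_all, linarith+)
  then have "\<bar>a\<bar> \<le> 1" "\<bar>b\<bar> \<le> 1"
    using power2_le_iff_abs_le[of 1 a] power2_le_iff_abs_le[of 1 b] by auto
  then have "a \<in> {-1, 0, 1}" "b \<in> {-1, 0, 1}"
    by auto
  then show ?thesis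
    using assms by auto
qed

text \<open>The squared moduli of \<open>u\<close> and \<open>v\<close> are nonnegative integers
  with product 1, so \<open>u\<close> has norm 1. Here \<open>v\<close> serves as the cofactor of
  \<open>u\<close> in a product known to be a unit.\<close>

lemma gauss_ints_unit:
  assumes "u \<in> gauss_ints" "v \<in> gauss_ints" "cmod (u * v) = 1"
  shows "u \<in> {1, -1, \<i>, -\<i>}"
proof -
  obtain a b where u: "u = Complex (of_int a) (of_int b)"
    using assms(1) by (rule gauss_intsE)
  obtain c d where v: "v = Complex (of_int c) (of_int d)"
    using assms(2) by (rule gauss_intsE)
  have "(cmod u)\<^sup>2 * (cmod v)\<^sup>2 = 1"
    using assms(3) by (simp add: norm_mult flip: power_mult_distrib)
  then have "real_of_int ((a\<^sup>2 + b\<^sup>2) * (c\<^sup>2 + d\<^sup>2)) = of_int 1"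
    by (simp add: u v cmod_power2)
  then have "(a\<^sup>2 + b\<^sup>2) * (c\<^sup>2 + d\<^sup>2) = 1"
    by (simp only: of_int_eq_iff)
  then have "a\<^sup>2 + b\<^sup>2 = 1"
    using zmult_eq_1_iff[of "a\<^sup>2 + b\<^sup>2" "c\<^sup>2 + d\<^sup>2"] zero_le_power2[of a] zero_le_power2[of b]
    by linarith
  from int_sum_squares_eq_1[OF this] show ?thesis
    by (auto simp: u complex_eq_iff)
qed

definition mult_1_i :: "complex \<Rightarrow> bool" where
  "mult_1_i w \<longleftrightarrow> (\<exists>v\<in>gauss_ints. w = (1 + \<i>) * v)"

lemma mult_1_i_intros:
  "mult_1_i 0" "mult_1_i 2"
  "mult_1_i u \<Longrightarrow> mult_1_i v \<Longrightarrow> mult_1_i (u + v)"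
  "mult_1_i u \<Longrightarrow> mult_1_i v \<Longrightarrow> mult_1_i (u - v)"
  "mult_1_i u \<Longrightarrow> v \<in> gauss_ints \<Longrightarrow> mult_1_i (u * v)"
  "mult_1_i v \<Longrightarrow> u \<in> gauss_ints \<Longrightarrow> mult_1_i (u * v)"
  "mult_1_i u \<Longrightarrow> mult_1_i (- u)"
proof -
  show "mult_1_i 0" "mult_1_i 2"
    unfolding mult_1_i_def by (force, intro bexI[of _ "1 - \<i>"]) (auto simp: algebra_simps)
  show "mult_1_i u \<Longrightarrow> mult_1_i v \<Longrightarrow> mult_1_i (u + v)"
    unfolding mult_1_i_def by (metis distrib_left gauss_ints_intros(5))
  show "mult_1_i u \<Longrightarrow> mult_1_i v \<Longrightarrow> mult_1_i (u - v)"
    unfolding mult_1_i_def by (metis right_diff_distrib gauss_ints_intros(6))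
  show "mult_1_i u \<Longrightarrow> v \<in> gauss_ints \<Longrightarrow> mult_1_i (u * v)"
    unfolding mult_1_i_def by (metis mult.assoc gauss_ints_intros(7))
  show "mult_1_i v \<Longrightarrow> u \<in> gauss_ints \<Longrightarrow> mult_1_i (u * v)"
    unfolding mult_1_i_def by (metis mult.left_commute gauss_ints_intros(7))
  show "mult_1_i u \<Longrightarrow> mult_1_i (- u)"
    unfolding mult_1_i_def by (metis mult_minus_right gauss_ints_intros(8))
qed

lemma gauss_square_eq_4:
  assumes x: "x \<in> gauss_ints"
    and d: "d \<in> {1, -1, \<i>, -\<i>}" and e: "e \<in> {1, -1, \<i>, -\<i>}"
    and eq: "x\<^sup>2 = 4 + (1 + \<i>) * (d - e)"
  shows "x\<^sup>2 = 4"
proof -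
  obtain a b where ab: "x = Complex (of_int a) (of_int b)"
    using x by (rule gauss_intsE)
  define s t where "s = a\<^sup>2 - b\<^sup>2" and "t = 2 * a * b"
  have x2: "Re (x\<^sup>2) = of_int s" "Im (x\<^sup>2) = of_int t"
    by (simp_all add: ab s_def t_def power2_eq_square)
  \<comment> \<open>A difference of two units is 0, twice a unit, or a unit times
    \<open>1 + \<i>\<close>. Multiplying it by \<open>1 + \<i>\<close> shifts 4 by at most 2 in each
    coordinate.\<close>
  moreover have "Re (x\<^sup>2) \<in> {2, 4, 6}" "Im (x\<^sup>2) \<in> {-2, 0, 2}"
    using d e unfolding eq by auto
  ultimately have st: "s \<in> {2, 4, 6}" "t \<in> {-2, 0, 2}"
    by auto
  have s: "a\<^sup>2 - b\<^sup>2 = s" and t: "2 * a * b = t"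
    by (simp_all add: s_def t_def)
  \<comment> \<open>Otherwise \<open>a\<close> and \<open>b\<close> are both 1 or -1, and
    \<open>x\<^sup>2\<close> would be purely imaginary.\<close>
  have "t = 0"
  proof (rule ccontr)
    assume "t \<noteq> 0"
    then have "a * b = 1 \<or> a * b = -1"
      using st t by auto
    then have "(a * b)\<^sup>2 = 1"
      by auto
    then have "a\<^sup>2 * b\<^sup>2 = 1"
      by (simp add: power_mult_distrib)
    then have "a\<^sup>2 = b\<^sup>2"
      by (auto simp: zmult_eq_1_iff)
    then show False
      using s st by auto
  qed
  \<comment> \<open>If instead \<open>a = 0\<close>, then \<open>s\<close> would be at most 0. So
    \<open>s\<close> is the square of an integer, which rules out 2 and 6.\<close>
  then have "b = 0"
    using t s st zero_le_power2[of b] by (cases "a = 0") auto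
  have "s = 4"
  proof (rule ccontr)
    assume "s \<noteq> 4"
    then have "a\<^sup>2 = 2 \<or> a\<^sup>2 = 6"
      using s st \<open>b = 0\<close> by auto
    moreover have "\<bar>a\<bar> \<le> 1 \<or> \<bar>a\<bar> = 2 \<or> 3 \<le> \<bar>a\<bar>"
      by auto
    moreover have "\<bar>a\<bar>\<^sup>2 \<le> 1\<^sup>2" if "\<bar>a\<bar> \<le> 1"
      using that by (intro power_mono) auto
    moreover have "3\<^sup>2 \<le> \<bar>a\<bar>\<^sup>2" if "3 \<le> \<bar>a\<bar>"
      using that by (intro power_mono) auto
    moreover have "a\<^sup>2 = 4" if "\<bar>a\<bar> = 2"
      using that power2_abs[of a] by simp
    ultimately show False
      by auto
  qed
  then show ?thesis
    using x2 \<open>t = 0\<close> by (simp add: complex_eq_iff)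
qed

section \<open>Integral matrices and reduction modulo \<open>1 + \<i>\<close>\<close>

lemmas mat2_entries = vec_eq_iff forall_2 matrix_matrix_mult_def sum_2 mat_def

lemma mat2_sel [simp]:
  "mat2 a b c d $ 1 $ 1 = a" "mat2 a b c d $ 1 $ 2 = b"
  "mat2 a b c d $ 2 $ 1 = c" "mat2 a b c d $ 2 $ 2 = d"
  by (simp_all add: mat2_def)

lemma det_sl2_inv: "det (sl2_inv M) = det M"
  by (simp add: sl2_inv_def det_2 algebra_simps)

definition integral_mat :: "mat2 \<Rightarrow> bool" where
  "integral_mat M \<longleftrightarrow> (\<forall>i j. M $ i $ j \<in> gauss_ints)"

lemma integral_mat_intros:
  "integral_mat (mat 1)"
  "integral_mat M \<Longrightarrow> integral_mat (- M)"
  "integral_mat M \<Longrightarrow> integral_mat N \<Longrightarrow> integral_mat (M + N)"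
  "integral_mat M \<Longrightarrow> integral_mat N \<Longrightarrow> integral_mat (M ** N)"
  "integral_mat M \<Longrightarrow> integral_mat (sl2_inv M)"
  by (auto simp: integral_mat_def sl2_inv_def mat2_entries)

lemma det_integral_mat: "integral_mat M \<Longrightarrow> det M \<in> gauss_ints"
  by (auto simp: integral_mat_def det_2)

text \<open>The residue field modulo \<open>1 + \<i>\<close> has two elements. There
  \<open>matB\<close> and \<open>- mat 1\<close> become the identity and \<open>matA\<close> is
  upper unitriangular, so only the upper right entry is left free.\<close>

definition unipotent_mod_1_i :: "mat2 \<Rightarrow> bool" where
  "unipotent_mod_1_i M \<longleftrightarrow> integral_mat M \<and> det M = 1 \<and>
    mult_1_i (M $ 2 $ 1) \<and> mult_1_i (M $ 1 $ 1 - 1) \<and> mult_1_i (M $ 2 $ 2 - 1)"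

lemma unipotent_mod_1_i_mult:
  assumes "unipotent_mod_1_i M" "unipotent_mod_1_i N"
  shows "unipotent_mod_1_i (M ** N)"
proof -
  note M = assms(1)[unfolded unipotent_mod_1_i_def] and N = assms(2)[unfolded unipotent_mod_1_i_def]
  have ints: "M $ i $ j \<in> gauss_ints" "N $ i $ j \<in> gauss_ints" for i j
    using M N by (auto simp: integral_mat_def)
  have "(M ** N) $ 2 $ 1 = M $ 2 $ 1 * N $ 1 $ 1 + M $ 2 $ 2 * N $ 2 $ 1"
    "(M ** N) $ 1 $ 1 - 1 = (M $ 1 $ 1 - 1) * N $ 1 $ 1 + (N $ 1 $ 1 - 1) + M $ 1 $ 2 * N $ 2 $ 1"
    "(M ** N) $ 2 $ 2 - 1 = (M $ 2 $ 2 - 1) * N $ 2 $ 2 + (N $ 2 $ 2 - 1) + M $ 2 $ 1 * N $ 1 $ 2"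
    by (simp_all add: mat2_entries algebra_simps)
  then have "mult_1_i ((M ** N) $ 2 $ 1)" "mult_1_i ((M ** N) $ 1 $ 1 - 1)"
    "mult_1_i ((M ** N) $ 2 $ 2 - 1)"
    using M N ints by (simp_all only: mult_1_i_intros)
  then show ?thesis
    using M N unfolding unipotent_mod_1_i_def by (simp add: det_mul integral_mat_intros)
qed

lemma unipotent_mod_1_i_inv:
  assumes "unipotent_mod_1_i M"
  shows "unipotent_mod_1_i (sl2_inv M)"
  using assms integral_mat_intros(5)[of M] det_sl2_inv[of M] unfolding unipotent_mod_1_i_def
  by (simp add: sl2_inv_def mult_1_i_intros)

lemma Gamma_lift_unipotent_mod_1_i:
  assumes "M \<in> Gamma_lift"
  shows "unipotent_mod_1_i M"
proof -
  have "mult_1_i (1 + \<i>)" "mult_1_i (-2)"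
    using mult_1_i_intros(7)[OF mult_1_i_intros(2)]
    by (auto simp: mult_1_i_def intro: bexI[of _ 1])
  then have gens: "unipotent_mod_1_i matA" "unipotent_mod_1_i matB" "unipotent_mod_1_i (- mat 1)"
    by (auto simp: unipotent_mod_1_i_def integral_mat_def forall_2 matA_def matB_def det_2 mat_def
        mult_1_i_intros)
  show ?thesis
    using assms unfolding Gamma_lift_def
  proof induction
    case one
    then show ?case
      using integral_mat_intros(1)
      by (simp add: unipotent_mod_1_i_def mult_1_i_intros) (simp add: mat_def mult_1_i_intros)
  next
    case (mul x s)
    then show ?case using gens by (auto intro: unipotent_mod_1_i_mult)
  next
    case (mul_inv x s)
    then show ?case using gens by (auto intro: unipotent_mod_1_i_mult unipotent_mod_1_i_inv)
  qed
qed

lemma trace_unipotent_mod_1_i: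
  assumes "unipotent_mod_1_i M"
  shows "mult_1_i (trace M)"
proof -
  have "trace M = (M $ 1 $ 1 - 1) + (M $ 2 $ 2 - 1) + 2"
    by (simp add: trace_def sum_2)
  then show ?thesis
    using assms unfolding unipotent_mod_1_i_def by (simp only: mult_1_i_intros)
qed

section \<open>Additive commutators and their determinant\<close>

lemma commutator_integral_multiple:
  assumes S: "\<And>s. s \<in> S \<Longrightarrow> integral_mat s"
    and K: "\<And>s. s \<in> S \<Longrightarrow> K ** s = sl2_inv s ** K"
    and a: "\<And>s. s \<in> S \<Longrightarrow> \<exists>N. integral_mat N \<and> a ** s - s ** a = N ** K"
    and P: "P \<in> sl2_gen S"
  shows "integral_mat P \<and> (\<exists>N. integral_mat N \<and> a ** P - P ** a = N ** K)"
  using P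
proof induction
  case one
  have "integral_mat 0" "a ** mat 1 - mat 1 ** a = 0 ** K"
    by (auto simp: integral_mat_def mat2_entries)
  then show ?case
    using integral_mat_intros(1) by blast
next
  case (mul x s)
  then obtain N where N: "integral_mat N" "a ** x - x ** a = N ** K"
    by blast
  obtain N' where N': "integral_mat N'" "a ** s - s ** a = N' ** K"
    using a mul by blast
  \<comment> \<open>Leibniz rule for the commutator with \<open>a\<close>. Moving \<open>s\<close>
    across \<open>K\<close> turns it into \<open>sl2_inv s\<close>, so all coefficients end up to
    the left of \<open>K\<close>; the one containing \<open>x\<close> is integral because
    integrality of \<open>x\<close> is carried through the induction.\<close>
  have "a ** (x ** s) - (x ** s) ** a = (a ** x - x ** a) ** s + x ** (a ** s - s ** a)"
    by (simp add: mat2_entries algebra_simps)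
  also have "\<dots> = N ** (K ** s) + x ** (N' ** K)"
    unfolding N N' by (simp add: matrix_mul_assoc)
  also have "\<dots> = (N ** sl2_inv s + x ** N') ** K"
    unfolding K[OF mul.hyps(2)] by (simp add: mat2_entries algebra_simps)
  finally show ?case
    using N N' mul S by (intro conjI exI[of _ "N ** sl2_inv s + x ** N'"] integral_mat_intros) auto
next
  case (mul_inv x s)
  then obtain N where N: "integral_mat N" "a ** x - x ** a = N ** K"
    by blast
  obtain N' where N': "integral_mat N'" "a ** s - s ** a = N' ** K"
    using a mul_inv by blast
  \<comment> \<open>Since \<open>sl2_inv s\<close> is the adjugate, it equals \<open>trace s\<close>
    times the identity minus \<open>s\<close>; commuting it with \<open>a\<close> therefore only
    changes the sign.\<close>
  have "a ** (x ** sl2_inv s) - (x ** sl2_inv s) ** a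
      = (a ** x - x ** a) ** sl2_inv s - x ** (a ** s - s ** a)"
    by (simp add: mat2_entries sl2_inv_def algebra_simps)
  also have "\<dots> = N ** (K ** sl2_inv s) - x ** (N' ** K)"
    unfolding N N' by (simp add: matrix_mul_assoc)
  also have "K ** sl2_inv s = s ** K"
  proof -
    \<comment> \<open>Both sides are \<open>trace s\<close> times \<open>K\<close>.\<close>
    have "K ** s + K ** sl2_inv s = sl2_inv s ** K + s ** K"
      by (simp add: mat2_entries sl2_inv_def algebra_simps)
    then show ?thesis
      using K[OF mul_inv.hyps(2)] by simp
  qed
  also have "N ** (s ** K) - x ** (N' ** K) = (N ** s + - (x ** N')) ** K"
    by (simp add: mat2_entries algebra_simps)
  finally show ?case
    using N N' mul_inv S by (intro conjI exI[of _ "N ** s + - (x ** N')"] integral_mat_intros) auto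
qed

lemma commutators_in_sl2_gen:
  fixes X Y :: mat2
  defines "K \<equiv> X ** Y - Y ** X"
  assumes X: "integral_mat X" and Y: "integral_mat Y"
    and P: "P \<in> sl2_gen {X, Y, - mat 1}" and Q: "Q \<in> sl2_gen {X, Y, - mat 1}"
  shows "\<exists>N. integral_mat N \<and> P ** Q - Q ** P = N ** K"
proof -
  let ?S = "{X, Y, - mat 1}"
  have S: "integral_mat s" if "s \<in> ?S" for s
    using that X Y by (auto intro: integral_mat_intros)
  \<comment> \<open>The adjugate reverses products and negates traceless matrices. As
    \<open>K\<close> and \<open>K ** s\<close> are traceless, taking the adjugate of
    \<open>K ** s\<close> gives this identity.\<close>
  have K: "K ** s = sl2_inv s ** K" if "s \<in> ?S" for s
    using that by (auto simp: K_def mat2_entries sl2_inv_def algebra_simps)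
  have I: "\<exists>N. integral_mat N \<and> M = N ** K" if "M \<in> {0, K, - K}" for M
  proof -
    have "0 = 0 ** K" "K = mat 1 ** K" "- K = (- mat 1) ** K"
      by (simp_all add: mat2_entries)
    moreover have "integral_mat 0"
      by (auto simp: integral_mat_def)
    ultimately show ?thesis
      using that integral_mat_intros(1,2) by blast
  qed
  have gens: "a ** s - s ** a \<in> {0, K, - K}" if "a \<in> ?S" "s \<in> ?S" for a s
  proof -
    have "M ** (- mat 1) = (- mat 1) ** M" for M :: mat2
      by (simp add: mat2_entries)
    then show ?thesis
      using that by (auto simp: K_def)
  qed
  \<comment> \<open>The preceding lemma is used twice: first with a generator as \<open>a\<close>,
    to reach \<open>P\<close>, then with \<open>P\<close> as \<open>a\<close>, to reach
    \<open>Q\<close>.\<close>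
  have "\<exists>N. integral_mat N \<and> P ** s - s ** P = N ** K" if s: "s \<in> ?S" for s
  proof -
    obtain N where "integral_mat N" "s ** P - P ** s = N ** K"
      using commutator_integral_multiple[OF S K I[OF gens[OF s]] P] by auto
    moreover have "P ** s - s ** P = - (s ** P - P ** s)"
      by simp
    moreover have "- (N ** K) = (- N) ** K"
      by (simp add: mat2_entries)
    ultimately show ?thesis
      using integral_mat_intros(2) by metis
  qed
  then show ?thesis
    using commutator_integral_multiple[OF S K _ Q, of P] by auto
qed

text \<open>Factoring out \<open>Y ** X\<close> shows that this determinant is 2 minus the trace of
  the group commutator of \<open>X\<close> and \<open>Y\<close>; the right side is then Fricke's
  trace identity.\<close>

lemma det_commutator:
  fixes X Y :: mat2
  assumes "det X = 1" "det Y = 1"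
  shows "det (X ** Y - Y ** X)
    = 4 - (trace X)\<^sup>2 - (trace Y)\<^sup>2 - (trace (X ** Y))\<^sup>2 + trace X * trace Y * trace (X ** Y)"
  using assms unfolding det_2 trace_def sum_2 matrix_matrix_mult_def vector_minus_component vec_lambda_beta
  by algebra

theorem theorem1p3:
  fixes X Y :: mat2
  assumes "X \<in> Gamma_lift" and "Y \<in> Gamma_lift"
    and "sl2_gen {X, Y, - mat 1} = Gamma_lift"
    and "trace X = trace Y \<or> trace X = - trace Y"
  shows "parabolic X \<and> parabolic Y"
proof -
  let ?K = "X ** Y - Y ** X"
  note X = Gamma_lift_unipotent_mod_1_i[OF assms(1)]
  note Y = Gamma_lift_unipotent_mod_1_i[OF assms(2)]
  have int: "integral_mat X" "integral_mat Y" and det: "det X = 1" "det Y = 1"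
    using X Y by (auto simp: unipotent_mod_1_i_def)
  have "mat 1 ** matA \<in> Gamma_lift" "mat 1 ** matB \<in> Gamma_lift"
    unfolding Gamma_lift_def by (intro sl2_gen.intros; simp)+
  then obtain N where N: "integral_mat N" "matA ** matB - matB ** matA = N ** ?K"
    using commutators_in_sl2_gen[OF int, of matA matB] assms(3) by auto
  have "det (matA ** matB - matB ** matA) = - (2 * \<i>)"
    by (simp add: det_2 matA_def matB_def mat2_entries algebra_simps)
  then have detK: "det N * det ?K = - (2 * \<i>)"
    using N(2) by (simp add: det_mul)
  define x where "x = trace X"
  \<comment> \<open>If the traces differ by a sign, replacing the lift \<open>Y\<close> by
    \<open>- Y\<close> makes them equal and negates the trace of the product; \<open>z\<close> is
    the trace after this normalization.\<close>
  define z where "z = (if trace X = trace Y then trace (X ** Y) else - trace (X ** Y))"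
  have x: "mult_1_i x"
    unfolding x_def using trace_unipotent_mod_1_i[OF X] .
  have z: "mult_1_i z"
    unfolding z_def using trace_unipotent_mod_1_i[OF unipotent_mod_1_i_mult[OF X Y]]
    by (auto intro: mult_1_i_intros)
  have xG: "x \<in> gauss_ints"
    using x by (auto simp: mult_1_i_def)
  have K: "det ?K = - ((z - 2) * (z + 2 - x * x))"
    using assms(4) unfolding det_commutator[OF det] z_def x_def
    by (auto simp: power2_eq_square algebra_simps)
  obtain d where d: "d \<in> gauss_ints" "z - 2 = (1 + \<i>) * d"
    using mult_1_i_intros(4)[OF z mult_1_i_intros(2)] by (auto simp: mult_1_i_def)
  have "mult_1_i (z + 2 - x * x)"
    by (intro mult_1_i_intros z x xG)
  then obtain e where e: "e \<in> gauss_ints" "z + 2 - x * x = (1 + \<i>) * e"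
    by (auto simp: mult_1_i_def)
  \<comment> \<open>The two factors \<open>1 + \<i>\<close> already account for all of
    \<open>2 * \<i>\<close>, so what remains is a unit.\<close>
  have "2 * \<i> * (det N * d * e) = 2 * \<i>"
  proof -
    have "(1 + \<i>) * (1 + \<i>) = 2 * \<i>"
      by (simp add: algebra_simps)
    then show ?thesis
      using detK unfolding K d(2) e(2) by algebra
  qed
  then have unit: "det N * d * e = 1"
    by simp
  have "d \<in> {1, -1, \<i>, -\<i>}"
    using unit by (intro gauss_ints_unit[of d "det N * e"] d e gauss_ints_intros det_integral_mat N)
      (simp add: ac_simps)
  moreover have "e \<in> {1, -1, \<i>, -\<i>}"
    using unit by (intro gauss_ints_unit[of e "det N * d"] d e gauss_ints_intros det_integral_mat N)
      (simp add: ac_simps)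
  \<comment> \<open>Subtracting the two factorizations eliminates \<open>z\<close>.\<close>
  moreover have "x\<^sup>2 = 4 + (1 + \<i>) * (d - e)"
    using d(2) e(2) by (simp add: power2_eq_square algebra_simps)
  ultimately have "x\<^sup>2 = 4"
    using gauss_square_eq_4[OF xG] by blast
  then have tr: "(trace X)\<^sup>2 = 4" "(trace Y)\<^sup>2 = 4"
    using assms(4) by (auto simp: x_def)
  \<comment> \<open>If \<open>X\<close> or \<open>Y\<close> were plus or minus the identity, the two
    would commute and \<open>?K\<close> would vanish.\<close>
  have "det ?K \<noteq> 0"
    using detK by auto
  then have "X \<noteq> mat 1 \<and> X \<noteq> - mat 1 \<and> Y \<noteq> mat 1 \<and> Y \<noteq> - mat 1"
    by (auto simp: det_2 mat2_entries)
  then show ?thesis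
    using tr by (simp add: parabolic_def)
qed

end
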